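(* Let $\mu$ be a regular (infinite) cardinal and let $\lambda$ be a cardinal. Assume that (1) $(\lambda_i : i<\mu)$ is an increasing sequence of regular cardinals; (2) for each $j<\mu$, $\bigl|\prod_{i<j}\lambda_i\bigr| < \lambda_j$; (3) $\lambda$ is regular and $\mathrm{tcf}\bigl(\prod_{i<\mu}\lambda_i \big/ D^{bd}_\mu\bigr) = \lambda$; (4) $n\ge 2$ is a natural number. Then there is a linear order $J$ of size $\lambda$ such that $J^{n+1}$ has an antichain of size $\lambda$, and $J^{n}$ has no antichain of size $\lambda$.
   Context: An antichain in a partial order is a set of pairwise incomparable elements ($x,y$ are incomparable if neither $x\le y$ nor $y\le x$). For a linear order $J$, the power $J^m$ carries the product (pointwise) partial order. For a regular cardinal $\mu$, $D^{bd}_\mu$ is the filter of cobounded subsets of $\mu$, i.e. the filter dual to the ideal $\{A\subseteq\mu : \exists i<\mu\ A\subseteq i\}$ of bounded sets. $\prod_{i<\mu}\lambda_i$ is the set of all functions $f$ with domain $\mu$ satisfying $f(i)<\lambda_i$ for all $i$ (and similarly $\prod_{i<j}\lambda_i$ for functions with domain $j$). The relation $f\sim g \Leftrightarrow \{i<\mu: f(i)=g(i)\}\in D^{bd}_\mu$ is an equivalence relation on $\prod_{i<\mu}\lambda_i$, and the quotient $\prod_{i<\mu}\lambda_i/D^{bd}_\mu$ is partially ordered by $f<_{D^{bd}_\mu} g$ iff $\{i<\mu : f(i)<g(i)\}\in D^{bd}_\mu$. For a partial order $(P,\le)$ and a regular cardinal $\lambda$, $\lambda=\mathrm{tcf}(P)$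 ("$\lambda$ is the true cofinality of $P$") means that there is an increasing sequence $(p_i : i<\lambda)$ in $P$ such that for every $p\in P$ there is $i<\lambda$ with $p\le p_i$. *)

theory Defs
  imports "HOL-Library.FuncSet"
begin

unbundle cardinal_syntax

text \<open>
  Cardinals are represented as in the library: a cardinal is a relation \<open>r\<close> with \<open>Card_order r\<close>,
  its elements (the ordinals below it) are the members of \<open>Field r\<close>, and the initial segment
  determined by \<open>j\<close> (that is, the ordinal \<open>j\<close> as a set) is \<open>underS r j\<close>.
  The library's \<open>regularCard\<close> also holds, vacuously, for finite cardinals, so infinity is required
  separately.
\<close>

definition regular_cardinal :: "'a rel \<Rightarrow> bool" where
  "regular_cardinal r \<longleftrightarrow> Cinfinite r \<and> regularCard r"

definition cobounded_filter :: "'a rel \<Rightarrow> 'a set set" where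
  "cobounded_filter \<mu> =
     {A. A \<subseteq> Field \<mu> \<and> (\<exists>i\<in>Field \<mu>. Field \<mu> - A \<subseteq> underS \<mu> i)}"

definition card_product :: "'a set \<Rightarrow> ('a \<Rightarrow> 'b rel) \<Rightarrow> ('a \<Rightarrow> 'b) set" where
  "card_product I L = (\<Pi>\<^sub>E i\<in>I. Field (L i))"

definition eq_mod_bd :: "'a rel \<Rightarrow> ('a \<Rightarrow> 'b rel) \<Rightarrow> ('a \<Rightarrow> 'b) rel" where
  "eq_mod_bd \<mu> L =
     {(f, g). f \<in> card_product (Field \<mu>) L \<and> g \<in> card_product (Field \<mu>) L \<and>
              {i\<in>Field \<mu>. f i = g i} \<in> cobounded_filter \<mu>}"

definition less_mod_bd :: "'a rel \<Rightarrow> ('a \<Rightarrow> 'b rel) \<Rightarrow> ('a \<Rightarrow> 'b) rel" where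
  "less_mod_bd \<mu> L =
     {(f, g). f \<in> card_product (Field \<mu>) L \<and> g \<in> card_product (Field \<mu>) L \<and>
              {i\<in>Field \<mu>. f i \<in> underS (L i) (g i)} \<in> cobounded_filter \<mu>}"

text \<open>
  The (reflexive) partial order on the reduced product: the reflexive closure of the strict order
  that \<open>less_mod_bd\<close> induces on the equivalence classes.  The choice of representatives is
  irrelevant, see \<open>reduced_product_class_iff\<close> below.
\<close>

definition reduced_product :: "'a rel \<Rightarrow> ('a \<Rightarrow> 'b rel) \<Rightarrow> ('a \<Rightarrow> 'b) set rel" where
  "reduced_product \<mu> L =
     {(F, G). F \<in> card_product (Field \<mu>) L // eq_mod_bd \<mu> L \<and>
              G \<in> card_product (Field \<mu>) L // eq_mod_bd \<mu> L \<and>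
              (F = G \<or> (\<exists>f\<in>F. \<exists>g\<in>G. (f, g) \<in> less_mod_bd \<mu> L))}"

text \<open>
  \<open>is_tcf P \<lambda>\<close> says that \<open>\<lambda>\<close> is the true cofinality of the partial order \<open>P\<close> (a reflexive relation
  with underlying set \<open>Field P\<close>).  Increasing means strictly increasing.
\<close>

definition is_tcf :: "'p rel \<Rightarrow> 'c rel \<Rightarrow> bool" where
  "is_tcf P lam \<longleftrightarrow> regular_cardinal lam \<and>
     (\<exists>p. (\<forall>i\<in>Field lam. p i \<in> Field P) \<and>
          (\<forall>j\<in>Field lam. \<forall>i\<in>underS lam j. (p i, p j) \<in> P \<and> p i \<noteq> p j) \<and>
          (\<forall>x\<in>Field P. \<exists>i\<in>Field lam. (x, p i) \<in> P))"

definition power_order :: "'c rel \<Rightarrow> nat \<Rightarrow> (nat \<Rightarrow> 'c) rel" where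
  "power_order J m =
     {(x, y). x \<in> {..<m} \<rightarrow>\<^sub>E Field J \<and> y \<in> {..<m} \<rightarrow>\<^sub>E Field J \<and> (\<forall>k<m. (x k, y k) \<in> J)}"

definition antichain_in :: "'p rel \<Rightarrow> 'p set \<Rightarrow> bool" where
  "antichain_in P A \<longleftrightarrow>
     A \<subseteq> Field P \<and> (\<forall>x\<in>A. \<forall>y\<in>A. x \<noteq> y \<longrightarrow> (x, y) \<notin> P \<and> (y, x) \<notin> P)"

lemma cobounded_filter_Int:
  assumes "Card_order \<mu>" "A \<in> cobounded_filter \<mu>" "B \<in> cobounded_filter \<mu>"
  shows "A \<inter> B \<in> cobounded_filter \<mu>"
proof -
  interpret wo_rel \<mu>
    using assms(1) by (simp add: card_order_on_well_order_on wo_rel_def)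
  obtain i j where i: "i \<in> Field \<mu>" "Field \<mu> - A \<subseteq> underS i"
    and j: "j \<in> Field \<mu>" "Field \<mu> - B \<subseteq> underS j"
    using assms(2,3) by (auto simp: cobounded_filter_def)
  have "underS i \<subseteq> underS j \<or> underS j \<subseteq> underS i"
    using i(1) j(1) by (metis TOTALS ANTISYM TRANS underS_incr)
  then have "Field \<mu> - A \<inter> B \<subseteq> underS i \<or> Field \<mu> - A \<inter> B \<subseteq> underS j"
    using i(2) j(2) by blast
  then show ?thesis
    using i(1) j(1) assms(2,3) by (auto simp: cobounded_filter_def)
qed

lemma cobounded_filter_mono:
  assumes "A \<in> cobounded_filter \<mu>" "A \<subseteq> B" "B \<subseteq> Field \<mu>"
  shows "B \<in> cobounded_filter \<mu>"
  using assms unfolding cobounded_filter_def by blast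

lemma Field_in_cobounded_filter:
  assumes "Field \<mu> \<noteq> {}"
  shows "Field \<mu> \<in> cobounded_filter \<mu>"
  using assms by (auto simp: cobounded_filter_def)

lemma empty_notin_cobounded_filter: "{} \<notin> cobounded_filter \<mu>"
  by (auto simp: cobounded_filter_def underS_def)

lemma equiv_eq_mod_bd:
  assumes "Cinfinite \<mu>"
  shows "equiv (card_product (Field \<mu>) L) (eq_mod_bd \<mu> L)"
proof (rule equivI)
  show "eq_mod_bd \<mu> L \<subseteq> card_product (Field \<mu>) L \<times> card_product (Field \<mu>) L"
    by (auto simp: eq_mod_bd_def)
  have "Field \<mu> \<noteq> {}"
    using assms by (auto simp: cinfinite_def)
  then show "refl_on (card_product (Field \<mu>) L) (eq_mod_bd \<mu> L)"
    by (auto simp: refl_on_def eq_mod_bd_def Field_in_cobounded_filter)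
  show "sym (eq_mod_bd \<mu> L)"
    by (auto simp: sym_def eq_mod_bd_def eq_commute)
  show "trans (eq_mod_bd \<mu> L)"
  proof (rule transI)
    fix f g h
    assume fg: "(f, g) \<in> eq_mod_bd \<mu> L" and gh: "(g, h) \<in> eq_mod_bd \<mu> L"
    have "{i\<in>Field \<mu>. f i = g i} \<inter> {i\<in>Field \<mu>. g i = h i} \<in> cobounded_filter \<mu>"
      using fg gh assms by (intro cobounded_filter_Int) (auto simp: eq_mod_bd_def)
    then have "{i\<in>Field \<mu>. f i = h i} \<in> cobounded_filter \<mu>"
      by (rule cobounded_filter_mono) auto
    with fg gh show "(f, h) \<in> eq_mod_bd \<mu> L"
      by (auto simp: eq_mod_bd_def)
  qed
qed

lemma less_mod_bd_cong:
  assumes "Card_order \<mu>" "(f, f') \<in> eq_mod_bd \<mu> L" "(g, g') \<in> eq_mod_bd \<mu> L"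
    and "(f, g) \<in> less_mod_bd \<mu> L"
  shows "(f', g') \<in> less_mod_bd \<mu> L"
proof -
  have "{i\<in>Field \<mu>. f i = f' i} \<inter>
        ({i\<in>Field \<mu>. g i = g' i} \<inter> {i\<in>Field \<mu>. f i \<in> underS (L i) (g i)}) \<in> cobounded_filter \<mu>"
    using assms by (intro cobounded_filter_Int) (auto simp: eq_mod_bd_def less_mod_bd_def)
  then have "{i\<in>Field \<mu>. f' i \<in> underS (L i) (g' i)} \<in> cobounded_filter \<mu>"
    by (rule cobounded_filter_mono) auto
  with assms show ?thesis
    by (auto simp: eq_mod_bd_def less_mod_bd_def)
qed

lemma reduced_product_class_iff:
  assumes "Cinfinite \<mu>"
    and "f \<in> card_product (Field \<mu>) L" "g \<in> card_product (Field \<mu>) L"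
  shows "(eq_mod_bd \<mu> L `` {f}, eq_mod_bd \<mu> L `` {g}) \<in> reduced_product \<mu> L \<longleftrightarrow>
           (f, g) \<in> eq_mod_bd \<mu> L \<or> (f, g) \<in> less_mod_bd \<mu> L"
proof -
  note eqv = equiv_eq_mod_bd[OF assms(1), of L]
  have 1: "eq_mod_bd \<mu> L `` {f} = eq_mod_bd \<mu> L `` {g} \<longleftrightarrow> (f, g) \<in> eq_mod_bd \<mu> L"
    using eq_equiv_class_iff[OF eqv assms(2,3)] .
  have refl: "(f, f) \<in> eq_mod_bd \<mu> L" "(g, g) \<in> eq_mod_bd \<mu> L"
    using eqv assms(2,3) by (auto simp: equiv_def refl_on_def)
  have sym: "(y, x) \<in> eq_mod_bd \<mu> L" if "(x, y) \<in> eq_mod_bd \<mu> L" for x y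
    using eqv that by (auto simp: equiv_def sym_def)
  have 2: "(\<exists>x\<in>eq_mod_bd \<mu> L `` {f}. \<exists>y\<in>eq_mod_bd \<mu> L `` {g}. (x, y) \<in> less_mod_bd \<mu> L) \<longleftrightarrow>
             (f, g) \<in> less_mod_bd \<mu> L"
  proof
    assume "\<exists>x\<in>eq_mod_bd \<mu> L `` {f}. \<exists>y\<in>eq_mod_bd \<mu> L `` {g}. (x, y) \<in> less_mod_bd \<mu> L"
    then obtain x y where "(f, x) \<in> eq_mod_bd \<mu> L" "(g, y) \<in> eq_mod_bd \<mu> L"
      "(x, y) \<in> less_mod_bd \<mu> L" by auto
    then show "(f, g) \<in> less_mod_bd \<mu> L"
      using less_mod_bd_cong[OF _ sym sym] assms(1) by simp
  qed (use refl in auto)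
  show ?thesis
    using assms(2,3) 1 2 by (simp add: reduced_product_def quotientI)
qed

lemma Partial_order_reduced_product:
  assumes "Cinfinite \<mu>" "\<forall>i\<in>Field \<mu>. Card_order (L i)"
  shows "partial_order_on (card_product (Field \<mu>) L // eq_mod_bd \<mu> L) (reduced_product \<mu> L)"
proof -
  let ?Q = "card_product (Field \<mu>) L // eq_mod_bd \<mu> L"
  let ?c = "\<lambda>f. eq_mod_bd \<mu> L `` {f}"
  note iff = reduced_product_class_iff[OF assms(1), of _ L]
  note eqv = equiv_eq_mod_bd[OF assms(1), of L]
  have L: "trans (L i)" "antisym (L i)" if "i \<in> Field \<mu>" for i
    using assms(2) that card_order_on_well_order_on[of "Field (L i)" "L i"]
    by (auto simp: well_order_on_def linear_order_on_def partial_order_on_def preorder_on_def)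
  have less_trans: "(f, h) \<in> less_mod_bd \<mu> L"
    if "(f, g) \<in> less_mod_bd \<mu> L" "(g, h) \<in> less_mod_bd \<mu> L" for f g h
  proof -
    have "{i\<in>Field \<mu>. f i \<in> underS (L i) (g i)} \<inter> {i\<in>Field \<mu>. g i \<in> underS (L i) (h i)}
            \<in> cobounded_filter \<mu>"
      using that assms by (intro cobounded_filter_Int) (auto simp: less_mod_bd_def)
    moreover have "f i \<in> underS (L i) (h i)"
      if "i \<in> Field \<mu>" "f i \<in> underS (L i) (g i)" "g i \<in> underS (L i) (h i)" for i
      using that(2,3) transD[OF L(1)[OF that(1)], of "f i" "g i" "h i"]
        antisymD[OF L(2)[OF that(1)], of "f i" "g i"] by (auto simp: underS_def)
    ultimately have "{i\<in>Field \<mu>. f i \<in> underS (L i) (h i)} \<in> cobounded_filter \<mu>"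
      by (elim cobounded_filter_mono) blast+
    with that show ?thesis by (auto simp: less_mod_bd_def)
  qed
  have less_irrefl: "(f, f) \<notin> less_mod_bd \<mu> L" for f
    by (simp add: less_mod_bd_def underS_def empty_notin_cobounded_filter)
  have cls: "\<exists>f\<in>card_product (Field \<mu>) L. F = ?c f" if "F \<in> ?Q" for F
    using that by (auto elim: quotientE)
  have eqc: "?c f = ?c g \<longleftrightarrow> (f, g) \<in> eq_mod_bd \<mu> L"
    if "f \<in> card_product (Field \<mu>) L" "g \<in> card_product (Field \<mu>) L" for f g
    using eq_equiv_class_iff[OF eqv that] .
  have sub: "reduced_product \<mu> L \<subseteq> ?Q \<times> ?Q"
    by (auto simp: reduced_product_def)
  have "antisym (reduced_product \<mu> L)"
  proof (rule antisymI, rule ccontr)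
    fix F G assume FG: "(F, G) \<in> reduced_product \<mu> L" "(G, F) \<in> reduced_product \<mu> L" "F \<noteq> G"
    obtain f g where fg: "f \<in> card_product (Field \<mu>) L" "g \<in> card_product (Field \<mu>) L"
      "F = ?c f" "G = ?c g" using FG(1) sub cls by blast
    then have "(f, g) \<in> less_mod_bd \<mu> L" "(g, f) \<in> less_mod_bd \<mu> L"
      using FG iff[of f g] iff[of g f] eqc[of f g] eqc[of g f] by auto
    then show False using less_trans less_irrefl by blast
  qed
  moreover have "trans (reduced_product \<mu> L)"
  proof (rule transI)
    fix F G H assume FGH: "(F, G) \<in> reduced_product \<mu> L" "(G, H) \<in> reduced_product \<mu> L"
    show "(F, H) \<in> reduced_product \<mu> L"
    proof (cases "F = G \<or> G = H")
      case False
      have "F \<in> ?Q" "G \<in> ?Q" "H \<in> ?Q"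
        using FGH sub by auto
      then obtain f g h where fgh: "f \<in> card_product (Field \<mu>) L"
        "g \<in> card_product (Field \<mu>) L" "h \<in> card_product (Field \<mu>) L"
        "F = ?c f" "G = ?c g" "H = ?c h"
        using cls[of F] cls[of G] cls[of H] by auto
      then have "(f, g) \<in> less_mod_bd \<mu> L" "(g, h) \<in> less_mod_bd \<mu> L"
        using FGH False iff[of f g] iff[of g h] eqc[of f g] eqc[of g h] by simp_all
      then show ?thesis using less_trans[of f g h] iff[of f h] fgh by simp
    qed (use FGH in auto)
  qed
  moreover have "refl_on ?Q (reduced_product \<mu> L)"
    by (auto simp: refl_on_def reduced_product_def)
  ultimately show ?thesis
    using sub by (simp add: partial_order_on_def preorder_on_def)
qed

end

theory Submission
  imports Defs
begin

text \<open>
  The true cofinality gives a scale: functions \<open>f \<alpha>\<close> (\<open>\<alpha> < \<lambda>\<close>) in the product that increase strictly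
  modulo bounded sets and are cofinal there. Two distinct \<open>f \<alpha>\<close>, \<open>f \<beta>\<close> have a first coordinate \<open>i\<close>
  at which they differ, so \<open>\<lambda>\<close> can be ordered lexicographically through the scale. Coordinates are
  coloured with \<open>n + 1\<close> colours, each colour occurring unboundedly often, and the \<open>k\<close>-th twisted order
  compares lexicographically but backwards whenever the first difference has colour \<open>k\<close>. The order
  \<open>J\<close> is the sum of the \<open>n + 1\<close> twisted orders.

  In \<open>J\<close> to the power \<open>n + 1\<close> consider the diagonal points: \<open>\<alpha>\<close> in the first copy, \<open>\<alpha>\<close> in the second,
  and so on. If \<open>f \<alpha>\<close> and \<open>f \<beta>\<close> first differ at a coordinate of colour \<open>k\<close>, then copy \<open>k\<close> orders
  \<open>\<alpha>\<close>, \<open>\<beta>\<close> in the opposite way to every other copy, so the two diagonal points are incomparable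
  (\<open>large_antichain\<close>).

  An \<open>n\<close>-tuple, however, meets at most \<open>n\<close> copies. Among \<open>\<lambda>\<close> many tuples, \<open>\<lambda>\<close> many meet the same
  copies in the same positions, and some colour \<open>l\<close> is left out: in the copies that occur, a first
  difference of colour \<open>l\<close> is compared forwards. So it suffices to find two tuples which in each
  position are equal or first differ at one and the same coordinate of colour \<open>l\<close>, with the first
  tuple smaller there in all these positions. Thinning (\<open>thin_to_constant_or_unbounded\<close>) makes some
  positions constant and the remaining ones jointly unbounded in \<open>\<lambda>\<close>: for every bound, some tuple
  reaches it in all of them at once. Cofinality of the scale then
  yields a coordinate \<open>i\<close> of colour \<open>l\<close> at which the tuples of values are jointly unbounded in
  \<open>\<lambda>\<^sub>i\<close> (\<open>unbounded_coordinate\<close>). The product of the \<open>\<lambda>\<^sub>j\<close> for \<open>j < i\<close> is smaller than the regular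
  cardinal \<open>\<lambda>\<^sub>i\<close>, so unboundedness survives when the restrictions below \<open>i\<close> are fixed, and any tuple
  with these restrictions is exceeded at \<open>i\<close> by another one (\<open>same_below_and_less\<close>). These two tuples
  are comparable (\<open>no_large_antichain\<close>).
\<close>

section \<open>Lexicographic orders and sums of orders\<close>

lemma in_underS_trans:
  assumes "Linear_order r" "(x, y) \<in> r" "y \<in> underS r z"
  shows "x \<in> underS r z"
proof -
  have "trans r" "antisym r" using assms(1) by (simp_all add: order_on_defs)
  then show ?thesis
    using assms(2,3) transD[of r x y z] antisymD[of r x y] by (auto simp: underS_def)
qed

lemma in_underS_or_le:
  assumes "Linear_order r" "x \<in> Field r" "y \<in> Field r"
  shows "x \<in> underS r y \<or> (y, x) \<in> r"
proof (cases "x = y")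
  case True
  then show ?thesis using assms by (simp add: order_on_defs refl_on_def)
next
  case False
  then show ?thesis using assms by (auto simp: order_on_defs total_on_def underS_def)
qed

lemma first_difference:
  assumes W: "Well_order W" and "f \<in> Pi\<^sub>E (Field W) B" "g \<in> Pi\<^sub>E (Field W) B" "f \<noteq> g"
  shows "\<exists>i\<in>Field W. (\<forall>j\<in>underS W i. f j = g j) \<and> f i \<noteq> g i"
proof -
  let ?D = "{i\<in>Field W. f i \<noteq> g i}"
  have ne: "?D \<noteq> {}"
    using assms(2-4) PiE_ext[of f "Field W" B g] by auto
  have wf: "wf (W - Id)"
    using W by (simp add: well_order_on_def)
  obtain i where i: "i \<in> ?D" "\<And>j. (j, i) \<in> W - Id \<Longrightarrow> j \<notin> ?D"
    using ne wfE_min[OF wf] by (metis (no_types, lifting) all_not_in_conv)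
  moreover have "f j = g j" if "j \<in> underS W i" for j
    using that i(2)[of j] by (auto simp: underS_def Field_def)
  ultimately show ?thesis by auto
qed

definition lex_order :: "'a rel \<Rightarrow> ('a \<Rightarrow> 'b rel) \<Rightarrow> ('a \<Rightarrow> 'b) rel" where
  "lex_order W R =
     {(f, g). f \<in> card_product (Field W) R \<and> g \<in> card_product (Field W) R \<and>
        (f = g \<or> (\<exists>i\<in>Field W. (\<forall>j\<in>underS W i. f j = g j) \<and> f i \<noteq> g i \<and> (f i, g i) \<in> R i))}"

lemma linear_order_lex_order:
  assumes W: "Well_order W" and R: "\<And>i. i \<in> Field W \<Longrightarrow> Linear_order (R i)"
  shows "linear_order_on (card_product (Field W) R) (lex_order W R)"
proof -
  let ?P = "card_product (Field W) R"
  have tri: "i = i' \<or> i \<in> underS W i' \<or> i' \<in> underS W i" if "i \<in> Field W" "i' \<in> Field W" for i i'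
    using W that by (auto simp: order_on_defs total_on_def underS_def)
  have trW: "j \<in> underS W i'" if "j \<in> underS W i" "i \<in> underS W i'" for i i' j
    using W that in_underS_trans[of W j i i'] by (auto simp: order_on_defs underS_def)
  have trR: "(x, z) \<in> R i" if "i \<in> Field W" "(x, y) \<in> R i" "(y, z) \<in> R i" for i x y z
    using R[OF that(1)] that by (auto simp: order_on_defs dest: transD)
  have asR: "x = y" if "i \<in> Field W" "(x, y) \<in> R i" "(y, x) \<in> R i" for i x y
    using R[OF that(1)] that by (auto simp: order_on_defs dest: antisymD)
  have toR: "(x, y) \<in> R i \<or> (y, x) \<in> R i"
    if "i \<in> Field W" "x \<in> Field (R i)" "y \<in> Field (R i)" "x \<noteq> y" for i x y
    using R[OF that(1)] that by (auto simp: order_on_defs total_on_def)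
  have "refl_on ?P (lex_order W R)"
    by (auto simp: refl_on_def lex_order_def)
  moreover have "lex_order W R \<subseteq> ?P \<times> ?P"
    by (auto simp: lex_order_def)
  moreover have "antisym (lex_order W R)"
  proof (rule antisymI, rule ccontr)
    fix f g assume fg: "(f, g) \<in> lex_order W R" "(g, f) \<in> lex_order W R" "f \<noteq> g"
    obtain i where i: "i \<in> Field W" "\<forall>j\<in>underS W i. f j = g j" "f i \<noteq> g i" "(f i, g i) \<in> R i"
      using fg by (auto simp: lex_order_def)
    obtain i' where i': "i' \<in> Field W" "\<forall>j\<in>underS W i'. g j = f j" "g i' \<noteq> f i'" "(g i', f i') \<in> R i'"
      using fg by (auto simp: lex_order_def)
    have "i = i'" using tri[OF i(1) i'(1)] i i' by metis
    then show False using asR i i' by metis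
  qed
  moreover have "trans (lex_order W R)"
  proof (rule transI)
    fix f g h assume fg: "(f, g) \<in> lex_order W R" and gh: "(g, h) \<in> lex_order W R"
    show "(f, h) \<in> lex_order W R"
    proof (cases "f = g \<or> g = h")
      case False
      obtain i where i: "i \<in> Field W" "\<forall>j\<in>underS W i. f j = g j" "f i \<noteq> g i" "(f i, g i) \<in> R i"
        using fg False by (auto simp: lex_order_def)
      obtain i' where i': "i' \<in> Field W" "\<forall>j\<in>underS W i'. g j = h j" "g i' \<noteq> h i'" "(g i', h i') \<in> R i'"
        using gh False by (auto simp: lex_order_def)
      have P: "f \<in> ?P" "h \<in> ?P" using fg gh by (auto simp: lex_order_def)
      consider "i = i'" | "i \<in> underS W i'" | "i' \<in> underS W i" using tri i(1) i'(1) by blast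
      then have "\<exists>i\<in>Field W. (\<forall>j\<in>underS W i. f j = h j) \<and> f i \<noteq> h i \<and> (f i, h i) \<in> R i"
      proof cases
        case 1
        then show ?thesis using i i' trR[OF i(1)] asR[OF i(1)] by metis
      next
        case 2
        then show ?thesis using i i' trW by (intro bexI[of _ i]) auto
      next
        case 3
        then show ?thesis using i i' trW by (intro bexI[of _ i']) auto
      qed
      then show ?thesis using P by (auto simp: lex_order_def)
    qed (use fg gh in auto)
  qed
  moreover have "total_on ?P (lex_order W R)"
  proof (rule total_onI)
    fix f g assume fg: "f \<in> ?P" "g \<in> ?P" "f \<noteq> g"
    obtain i where i: "i \<in> Field W" "\<forall>j\<in>underS W i. f j = g j" "f i \<noteq> g i"
      using first_difference[OF W _ _ fg(3)] fg(1,2) unfolding card_product_def by blast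
    have "f i \<in> Field (R i)" "g i \<in> Field (R i)"
      using fg i(1) by (auto simp: card_product_def)
    then have "(f i, g i) \<in> R i \<or> (g i, f i) \<in> R i"
      using toR i by blast
    then show "(f, g) \<in> lex_order W R \<or> (g, f) \<in> lex_order W R"
      using fg i unfolding lex_order_def by fastforce
  qed
  ultimately show ?thesis by (simp add: order_on_defs)
qed

text \<open>
  The lexicographic sum of the orders \<open>T k\<close>, presented on an arbitrary set \<open>D\<close> whose elements \<open>u\<close> stand
  for the pairs \<open>(c u, g u)\<close>. This form lets the sum live on the given cardinal itself.
\<close>

definition sum_order ::
    "'d set \<Rightarrow> ('d \<Rightarrow> 'k::linorder) \<Rightarrow> ('d \<Rightarrow> 'e) \<Rightarrow> ('k \<Rightarrow> 'e rel) \<Rightarrow> 'd rel" where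
  "sum_order D c g T =
     {(u, v). u \<in> D \<and> v \<in> D \<and> (c u < c v \<or> c u = c v \<and> (g u, g v) \<in> T (c u))}"

lemma linear_order_sum_order:
  assumes T: "\<And>k. linear_order_on E (T k)" and g: "\<And>u. u \<in> D \<Longrightarrow> g u \<in> E"
    and inj: "inj_on (\<lambda>u. (c u, g u)) D"
  shows "linear_order_on D (sum_order D c g T)"
proof -
  have "refl_on D (sum_order D c g T)" "sum_order D c g T \<subseteq> D \<times> D"
    using T g by (auto simp: refl_on_def sum_order_def order_on_defs)
  moreover have "trans (sum_order D c g T)"
  proof (rule transI)
    fix u v w assume uv: "(u, v) \<in> sum_order D c g T" "(v, w) \<in> sum_order D c g T"
    have "trans (T (c u))" using T[of "c u"] by (simp add: order_on_defs)
    then show "(u, w) \<in> sum_order D c g T"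
      using uv transD[of "T (c u)" "g u" "g v" "g w"] by (auto simp: sum_order_def)
  qed
  moreover have "antisym (sum_order D c g T)"
  proof (rule antisymI)
    fix u v assume uv: "(u, v) \<in> sum_order D c g T" "(v, u) \<in> sum_order D c g T"
    then have "c u = c v" "(g u, g v) \<in> T (c u)" "(g v, g u) \<in> T (c u)"
      by (auto simp: sum_order_def)
    then have "g u = g v" using T[of "c u"] by (auto simp: order_on_defs dest: antisymD)
    with \<open>c u = c v\<close> uv show "u = v" using inj by (auto simp: sum_order_def inj_on_def)
  qed
  moreover have "total_on D (sum_order D c g T)"
  proof (rule total_onI)
    fix u v assume uv: "u \<in> D" "v \<in> D" "u \<noteq> v"
    show "(u, v) \<in> sum_order D c g T \<or> (v, u) \<in> sum_order D c g T"
    proof (cases "c u = c v")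
      case True
      then have "g u \<noteq> g v" using inj uv by (auto simp: inj_on_def)
      then show ?thesis using True uv g T[of "c u"]
        by (auto simp: sum_order_def order_on_defs total_on_def)
    next
      case False
      then show ?thesis using uv by (auto simp: sum_order_def neq_iff)
    qed
  qed
  ultimately show ?thesis by (simp add: order_on_defs)
qed

section \<open>Regular cardinals\<close>

lemma regular_cardinalD:
  assumes "regular_cardinal r"
  shows "Card_order r" "infinite (Field r)" "Well_order r" "regularCard r" "stable r" "Linear_order r"
proof -
  show r: "Card_order r" "infinite (Field r)" "regularCard r"
    using assms by (auto simp: regular_cardinal_def cinfinite_def)
  then show "Well_order r" "stable r"
    by (simp_all add: card_order_on_well_order_on regularCard_stable)
  then show "Linear_order r" by (simp add: well_order_on_def)
qed

text \<open>
  Regularity is defined through the size of cofinal sets; the arguments below use it as the existence of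
  strict upper bounds: a set that is not cofinal has a bound, and \<open>r\<close> has no last element to stop there.
\<close>

lemma small_subset_bounded:
  assumes r: "regular_cardinal r" and B: "B \<subseteq> Field r" "|B| <o r"
  shows "\<exists>a\<in>Field r. \<forall>b\<in>B. b \<in> underS r a"
proof -
  note R = regular_cardinalD[OF r]
  have "\<not> cofinal B r"
    using R(4) B not_ordLess_ordIso[OF B(2)] by (auto simp: regularCard_def)
  then obtain a where a: "a \<in> Field r" "\<forall>b\<in>B. \<not> (a \<noteq> b \<and> (a, b) \<in> r)"
    by (auto simp: cofinal_def)
  obtain a' where a': "a \<noteq> a'" "(a, a') \<in> r"
    using infinite_Card_order_limit[OF R(1,2) a(1)] by auto
  have "b \<in> underS r a'" if "b \<in> B" for b
  proof -
    have "(b, a) \<in> r"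
      using a that B(1) in_underS_or_le[OF R(6), of a b] by (auto simp: underS_def)
    then show ?thesis
      using a' in_underS_trans[OF R(6), of b a a'] by (simp add: underS_def)
  qed
  then show ?thesis using a'(2) by (auto simp: Field_def)
qed

lemma finite_ordLess_regular:
  assumes "regular_cardinal r" "finite B"
  shows "|B| <o r"
proof (rule finite_ordLess_infinite)
  show "finite (Field |B| )" using assms(2) by (simp add: Field_card_of)
qed (use regular_cardinalD(2,3)[OF assms(1)] card_of_Well_order in auto)

text \<open>
  If each pattern \<open>b\<close> had a value \<open>\<nu> b\<close> that no element with pattern \<open>b\<close> reaches, a common bound of these
  few values would be reached by no element at all.
\<close>

lemma cofinal_pigeonhole:
  assumes r: "regular_cardinal r"
    and anti: "\<And>\<nu> \<nu>' x. (\<nu>, \<nu>') \<in> r \<Longrightarrow> x \<in> X \<Longrightarrow> Q \<nu>' x \<Longrightarrow> Q \<nu> x"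
    and ex: "\<And>\<nu>. \<nu> \<in> Field r \<Longrightarrow> \<exists>x\<in>X. Q \<nu> x"
    and pat: "\<And>x. x \<in> X \<Longrightarrow> pat x \<in> B" and B: "|B| <o r"
  shows "\<exists>b\<in>B. \<forall>\<nu>\<in>Field r. \<exists>x\<in>X. pat x = b \<and> Q \<nu> x"
proof (rule ccontr)
  assume "\<not> ?thesis"
  then obtain \<nu> where \<nu>: "\<And>b. b \<in> B \<Longrightarrow> \<nu> b \<in> Field r" "\<And>b x. b \<in> B \<Longrightarrow> x \<in> X \<Longrightarrow> pat x = b \<Longrightarrow> \<not> Q (\<nu> b) x"
    by metis
  have "|\<nu> ` B| <o r" using card_of_image B ordLeq_ordLess_trans by blast
  then obtain a where a: "a \<in> Field r" "\<forall>b\<in>\<nu> ` B. b \<in> underS r a"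
    using small_subset_bounded[OF r, of "\<nu> ` B"] \<nu>(1) by auto
  then obtain x where x: "x \<in> X" "Q a x" using ex by blast
  then have "Q (\<nu> (pat x)) x" using a(2) pat anti by (fastforce simp: underS_def)
  then show False using \<nu>(2) pat x by blast
qed

text \<open>
  Otherwise \<open>A\<close> would be a union of fewer than \<open>r\<close> sets, each of size below \<open>r\<close>.
\<close>

lemma fibre_of_full_size:
  assumes r: "regular_cardinal r" and A: "|A| =o r"
    and t: "\<And>a. a \<in> A \<Longrightarrow> t a \<in> B" and B: "|B| <o r"
  shows "\<exists>b\<in>B. |{a\<in>A. t a = b}| =o r"
proof (rule ccontr)
  note R = regular_cardinalD[OF r]
  assume "\<not> ?thesis"
  moreover have "|{a\<in>A. t a = b}| \<le>o r" for b
    using A ordLeq_ordIso_trans card_of_mono1[of "{a\<in>A. t a = b}" A] by blast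
  ultimately have "|{a\<in>A. t a = b}| <o r" if "b \<in> B" for b
    using that by (auto simp: ordLeq_iff_ordLess_or_ordIso)
  then have "|\<Union>b\<in>B. {a\<in>A. t a = b}| <o r" by (rule stable_UNION[OF R(5) B])
  moreover have "(\<Union>b\<in>B. {a\<in>A. t a = b}) = A" using t by auto
  ultimately show False using A not_ordLess_ordIso by force
qed

lemma card_of_PiE_finite_ordLess:
  fixes K :: "'k set" and P :: "'p set"
  assumes r: "regular_cardinal r" and P: "|P| <o r" and K: "finite K"
  shows "|K \<rightarrow>\<^sub>E P| <o r"
  using K
proof induction
  case empty
  have "|{\<lambda>x. undefined} :: ('k \<Rightarrow> 'p) set| <o r"
    by (rule finite_ordLess_regular[OF r]) simp
  then show ?case by simp
next
  case (insert k K)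
  have "|P \<times> (K \<rightarrow>\<^sub>E P)| <o r"
    using stable_elim[OF regular_cardinalD(5)[OF r] P, of "\<lambda>_. K \<rightarrow>\<^sub>E P"] insert.IH by simp
  then show ?case
    by (simp add: PiE_insert_eq) (use card_of_image ordLeq_ordLess_trans in blast)
qed

lemma ex_bij_betw_finite_Times:
  assumes "infinite A" "finite B" "B \<noteq> {}"
  shows "\<exists>b. bij_betw b A (B \<times> A)"
proof -
  have "|B| \<le>o |A|"
  proof (intro ordLess_imp_ordLeq finite_ordLess_infinite card_of_Well_order)
    show "finite (Field |B| )" "infinite (Field |A| )" using assms(1,2) by (simp_all add: Field_card_of)
  qed
  then have "|A| =o |B \<times> A|"
    using assms by (intro card_of_Times_infinite_simps) auto
  then show ?thesis using card_of_ordIso by blast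
qed

text \<open>
  Identify \<open>r\<close> with \<open>n + 1\<close> disjoint copies of itself. Each copy has full size, while a proper initial
  segment of a cardinal is too small to contain it.
\<close>

lemma unbounded_colouring:
  fixes r :: "'a rel"
  assumes r: "Cinfinite r"
  shows "\<exists>c :: 'a \<Rightarrow> nat. (\<forall>i\<in>Field r. c i \<le> n) \<and>
           (\<forall>k\<le>n. \<forall>j\<in>Field r. \<exists>i\<in>Field r. c i = k \<and> i \<notin> underS r j)"
proof -
  obtain b where b: "bij_betw b (Field r) ({..n} \<times> Field r)"
    using ex_bij_betw_finite_Times[of "Field r" "{..n}"] r by (auto simp: cinfinite_def)
  have "\<exists>i\<in>Field r. fst (b i) = k \<and> i \<notin> underS r j" if "k \<le> n" "j \<in> Field r" for k j
  proof (rule ccontr)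
    assume *: "\<not> ?thesis"
    have "Field r \<subseteq> (snd \<circ> b) ` underS r j"
    proof
      fix x assume "x \<in> Field r"
      then have "(k, x) \<in> b ` Field r" using b that by (auto simp: bij_betw_def)
      then obtain i where "i \<in> Field r" "b i = (k, x)" by force
      then show "x \<in> (snd \<circ> b) ` underS r j" using * by force
    qed
    then have "|Field r| \<le>o |underS r j|" by (rule surj_imp_ordLeq)
    moreover have "|underS r j| <o |Field r|"
    proof (rule ordLess_ordIso_trans)
      show "|underS r j| <o r" using r that(2) by (intro card_of_underS) auto
      show "r =o |Field r|"
        using r by (simp add: ordIso_symmetric[OF card_of_Field_ordIso])
    qed
    ultimately show False using not_ordLess_ordLeq[of "|underS r j|" "|Field r|"] by blast
  qed
  moreover have "fst (b i) \<le> n" if "i \<in> Field r" for i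
    using bij_betwE[OF b] that by (auto simp: mem_Times_iff)
  ultimately show ?thesis by (intro exI[of _ "fst \<circ> b"]) auto
qed

text \<open>
  Take a set \<open>K\<close> of positions of least size such that full-size many tuples agree outside \<open>K\<close>. By
  minimality no value is taken full-size often at a position in \<open>K\<close>, so by regularity
  the tuples with some entry below \<open>\<gamma>\<close> at a position in \<open>K\<close> are too few to exhaust all of them.
\<close>

lemma thin_to_constant_or_unbounded:
  fixes a :: "'x \<Rightarrow> 'k \<Rightarrow> 'c"
  assumes r: "regular_cardinal r" and A: "|A| =o r" and I: "finite I"
    and a: "\<And>x k. x \<in> A \<Longrightarrow> k \<in> I \<Longrightarrow> a x k \<in> Field r"
    and inj: "\<And>x y. x \<in> A \<Longrightarrow> y \<in> A \<Longrightarrow> (\<And>k. k \<in> I \<Longrightarrow> a x k = a y k) \<Longrightarrow> x = y"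
  shows "\<exists>A' K. A' \<subseteq> A \<and> K \<subseteq> I \<and> K \<noteq> {} \<and>
           (\<forall>x\<in>A'. \<forall>y\<in>A'. \<forall>k\<in>I - K. a x k = a y k) \<and>
           (\<forall>\<gamma>\<in>Field r. \<exists>x\<in>A'. \<forall>k\<in>K. (\<gamma>, a x k) \<in> r)"
proof -
  note R = regular_cardinalD[OF r]
  define good where "good K \<longleftrightarrow>
    K \<subseteq> I \<and> (\<exists>A'\<subseteq>A. |A'| =o r \<and> (\<forall>x\<in>A'. \<forall>y\<in>A'. \<forall>k\<in>I - K. a x k = a y k))" for K
  have "good I" unfolding good_def using A by blast
  then obtain K where K: "good K" and min: "\<And>K'. good K' \<Longrightarrow> card K \<le> card K'"
    using ex_has_least_nat[of good I card] by metis
  then obtain A' where A': "A' \<subseteq> A" "|A'| =o r" "\<And>x y k. x \<in> A' \<Longrightarrow> y \<in> A' \<Longrightarrow> k \<in> I - K \<Longrightarrow> a x k = a y k"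
    unfolding good_def by metis
  have "K \<subseteq> I" using K by (simp add: good_def)
  then have KI: "K \<subseteq> I" "finite K" using I finite_subset by auto
  have inf: "infinite A'"
    using A'(2) finite_ordLess_regular[OF r, of A'] not_ordLess_ordIso[of "|A'|" r] by blast
  have "K \<noteq> {}"
  proof
    assume "K = {}"
    obtain x where "x \<in> A'" using inf by fastforce
    have "y = x" if "y \<in> A'" for y
      using A'(1) \<open>x \<in> A'\<close> that A'(3)[OF that \<open>x \<in> A'\<close>] \<open>K = {}\<close> by (intro inj) auto
    then have "A' \<subseteq> {x}" by blast
    then show False using inf finite_subset[of A' "{x}"] by simp
  qed
  moreover have "\<exists>x\<in>A'. \<forall>k\<in>K. (\<gamma>, a x k) \<in> r" if \<gamma>: "\<gamma> \<in> Field r" for \<gamma>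
  proof (rule ccontr)
    assume none: "\<not> ?thesis"
    \<comment> \<open>if no tuple reaches \<open>\<gamma>\<close> throughout \<open>K\<close>, the few small fibres \<open>?F (k, \<delta>)\<close> cover \<open>A'\<close>\<close>
    let ?F = "\<lambda>(k, \<delta>). {x\<in>A'. a x k = \<delta>}"
    have small: "|?F p| <o r" if p: "p \<in> K \<times> underS r \<gamma>" for p
    proof (rule ccontr)
      obtain k \<delta> where k\<delta>: "p = (k, \<delta>)" "k \<in> K" using p by auto
      assume "\<not> |?F p| <o r"
      moreover have "|?F p| \<le>o r"
        using card_of_mono1[of "?F p" A'] k\<delta>(1) by (auto intro: ordLeq_ordIso_trans[OF _ A'(2)])
      ultimately have eq: "|{x\<in>A'. a x k = \<delta>}| =o r" using k\<delta> by (auto simp: ordLeq_iff_ordLess_or_ordIso)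
      \<comment> \<open>a full fibre at position \<open>k\<close> makes \<open>k\<close> constant, against the minimality of \<open>K\<close>\<close>
      have "good (K - {k})"
        unfolding good_def
      proof (intro conjI exI[of _ "{x\<in>A'. a x k = \<delta>}"] ballI)
        fix x y k'
        assume "x \<in> {x\<in>A'. a x k = \<delta>}" "y \<in> {x\<in>A'. a x k = \<delta>}" "k' \<in> I - (K - {k})"
        then show "a x k' = a y k'" using A'(3)[of x y k'] by (cases "k' = k") auto
      qed (use KI A'(1) eq in auto)
      then have "card K \<le> card (K - {k})" by (rule min)
      then show False using KI k\<delta> by (meson card_Diff1_less not_le)
    qed
    have "|K \<times> underS r \<gamma>| <o r"
      using stable_elim[OF R(5) finite_ordLess_regular[OF r KI(2)], of "\<lambda>_. underS r \<gamma>"]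
        card_of_underS[OF R(1) \<gamma>] by simp
    then have "|\<Union>p\<in>K \<times> underS r \<gamma>. ?F p| <o r" using small by (rule stable_UNION[OF R(5)])
    moreover have "A' \<subseteq> (\<Union>p\<in>K \<times> underS r \<gamma>. ?F p)"
    proof
      fix x assume x: "x \<in> A'"
      then obtain k where k: "k \<in> K" "(\<gamma>, a x k) \<notin> r" using none by blast
      have "a x k \<in> underS r \<gamma>"
      proof -
        have "a x k \<in> Field r" using k(1) x A'(1) KI(1) by (intro a) auto
        then show ?thesis
          using k(2) \<gamma> in_underS_or_le[OF R(6)] by blast
      qed
      then show "x \<in> (\<Union>p\<in>K \<times> underS r \<gamma>. ?F p)" using k x by auto
    qed
    ultimately have "|A'| <o r" using card_of_mono1 ordLeq_ordLess_trans by blast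
    then show False using A'(2) not_ordLess_ordIso by blast
  qed
  moreover have "\<forall>x\<in>A'. \<forall>y\<in>A'. \<forall>k\<in>I - K. a x k = a y k" using A'(3) by blast
  ultimately show ?thesis using A'(1) KI(1) by blast
qed

section \<open>Scales\<close>

text \<open>
  Representatives \<open>f \<alpha>\<close> of a sequence that witnesses the true cofinality; working with functions instead
  of their classes is what makes first differences available.
\<close>

locale scale =
  fixes \<mu> :: "'a rel" and L :: "'a \<Rightarrow> 'b rel" and lam :: "'c rel" and f :: "'c \<Rightarrow> 'a \<Rightarrow> 'b"
  assumes mu: "regular_cardinal \<mu>"
    and L: "\<And>i. i \<in> Field \<mu> \<Longrightarrow> regular_cardinal (L i)"
    and small: "\<And>i. i \<in> Field \<mu> \<Longrightarrow> |card_product (underS \<mu> i) L| <o L i"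
    and lam: "regular_cardinal lam"
    and f_in: "\<And>\<alpha>. \<alpha> \<in> Field lam \<Longrightarrow> f \<alpha> \<in> card_product (Field \<mu>) L"
    and f_mono: "\<And>\<alpha> \<beta>. \<beta> \<in> Field lam \<Longrightarrow> \<alpha> \<in> underS lam \<beta> \<Longrightarrow> (f \<alpha>, f \<beta>) \<in> less_mod_bd \<mu> L"
    and f_cof: "\<And>h. h \<in> card_product (Field \<mu>) L \<Longrightarrow>
                  \<exists>\<alpha>\<in>Field lam. (h, f \<alpha>) \<in> eq_mod_bd \<mu> L \<or> (h, f \<alpha>) \<in> less_mod_bd \<mu> L"

lemma scale_of_is_tcf:
  fixes \<mu> :: "'a rel" and L :: "'a \<Rightarrow> 'b rel" and lam :: "'c rel"
  assumes mu: "regular_cardinal \<mu>"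
    and L: "\<forall>i\<in>Field \<mu>. regular_cardinal (L i)"
    and small: "\<forall>i\<in>Field \<mu>. |card_product (underS \<mu> i) L| <o L i"
    and tcf: "is_tcf (reduced_product \<mu> L) lam"
  shows "\<exists>f. scale \<mu> L lam f"
proof -
  let ?E = "card_product (Field \<mu>) L" and ?P = "reduced_product \<mu> L"
  let ?c = "\<lambda>f. eq_mod_bd \<mu> L `` {f}"
  have inf: "Cinfinite \<mu>" using mu by (simp add: regular_cardinal_def)
  note iff = reduced_product_class_iff[OF inf, of _ L]
  have F: "Field ?P = ?E // eq_mod_bd \<mu> L"
    by (auto simp: reduced_product_def Field_def)
  obtain p where p: "\<And>\<alpha>. \<alpha> \<in> Field lam \<Longrightarrow> p \<alpha> \<in> Field ?P"
    "\<And>\<alpha> \<beta>. \<beta> \<in> Field lam \<Longrightarrow> \<alpha> \<in> underS lam \<beta> \<Longrightarrow> (p \<alpha>, p \<beta>) \<in> ?P \<and> p \<alpha> \<noteq> p \<beta>"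
    "\<And>x. x \<in> Field ?P \<Longrightarrow> \<exists>\<alpha>\<in>Field lam. (x, p \<alpha>) \<in> ?P"
    using tcf unfolding is_tcf_def by metis
  have "\<exists>f. f \<in> ?E \<and> p \<alpha> = ?c f" if "\<alpha> \<in> Field lam" for \<alpha>
    using p(1)[OF that] F by (auto elim: quotientE)
  then obtain f where f: "\<And>\<alpha>. \<alpha> \<in> Field lam \<Longrightarrow> f \<alpha> \<in> ?E" "\<And>\<alpha>. \<alpha> \<in> Field lam \<Longrightarrow> p \<alpha> = ?c (f \<alpha>)"
    by metis
  have "scale \<mu> L lam f"
  proof
    fix \<alpha> \<beta> assume \<beta>: "\<beta> \<in> Field lam" and \<alpha>\<beta>: "\<alpha> \<in> underS lam \<beta>"
    then have \<alpha>: "\<alpha> \<in> Field lam" by (auto simp: underS_def Field_def)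
    show "(f \<alpha>, f \<beta>) \<in> less_mod_bd \<mu> L"
      using p(2)[OF \<beta> \<alpha>\<beta>] f[OF \<alpha>] f[OF \<beta>] iff
        eq_equiv_class_iff[OF equiv_eq_mod_bd[OF inf, of L] f(1)[OF \<alpha>] f(1)[OF \<beta>]] by auto
  next
    fix h assume h: "h \<in> ?E"
    then have "?c h \<in> Field ?P" unfolding F by (rule quotientI)
    then obtain \<alpha> where "\<alpha> \<in> Field lam" "(?c h, p \<alpha>) \<in> ?P" using p(3) by blast
    then show "\<exists>\<alpha>\<in>Field lam. (h, f \<alpha>) \<in> eq_mod_bd \<mu> L \<or> (h, f \<alpha>) \<in> less_mod_bd \<mu> L"
      using iff[OF h] f by auto
  qed (use assms f in \<open>auto simp: is_tcf_def\<close>)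
  then show ?thesis by (rule exI[of "scale \<mu> L lam" f])
qed

lemma cobounded_filter_finite_Ball:
  assumes \<mu>: "Cinfinite \<mu>" and "finite K"
    and "\<And>k. k \<in> K \<Longrightarrow> {i\<in>Field \<mu>. P k i} \<in> cobounded_filter \<mu>"
  shows "{i\<in>Field \<mu>. \<forall>k\<in>K. P k i} \<in> cobounded_filter \<mu>"
  using assms(2,3)
proof induction
  case empty
  have "Field \<mu> \<noteq> {}" using \<mu> by (auto simp: cinfinite_def)
  then show ?case by (simp add: Field_in_cobounded_filter)
next
  case (insert k K)
  have "{i\<in>Field \<mu>. P k i} \<inter> {i\<in>Field \<mu>. \<forall>k\<in>K. P k i} \<in> cobounded_filter \<mu>"
    using \<mu> insert by (intro cobounded_filter_Int) auto
  then show ?case by (rule cobounded_filter_mono) auto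
qed

context scale
begin

lemma f_inj: "inj_on f (Field lam)"
proof (rule inj_onI, rule ccontr)
  fix \<alpha> \<beta> assume *: "\<alpha> \<in> Field lam" "\<beta> \<in> Field lam" "f \<alpha> = f \<beta>" "\<alpha> \<noteq> \<beta>"
  then have "\<alpha> \<in> underS lam \<beta> \<or> \<beta> \<in> underS lam \<alpha>"
    using in_underS_or_le[OF regular_cardinalD(6)[OF lam] *(1,2)] by (auto simp: underS_def)
  then have "(f \<alpha>, f \<alpha>) \<in> less_mod_bd \<mu> L" using f_mono * by metis
  then show False by (simp add: less_mod_bd_def underS_def empty_notin_cobounded_filter)
qed

text \<open>
  Cofinality bounds \<open>h\<close> only weakly and by one member of the scale; the next member is strictly above \<open>h\<close>
  on a cobounded set, and so are all later ones.
\<close>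

lemma eventually_dominates:
  assumes h: "h \<in> card_product (Field \<mu>) L"
  shows "\<exists>\<alpha>\<in>Field lam. \<forall>\<beta>. (\<alpha>, \<beta>) \<in> lam \<longrightarrow>
           {i\<in>Field \<mu>. h i \<in> underS (L i) (f \<beta> i)} \<in> cobounded_filter \<mu>"
proof -
  note linlam = regular_cardinalD(6)[OF lam]
  obtain \<alpha> where \<alpha>: "\<alpha> \<in> Field lam" "(h, f \<alpha>) \<in> eq_mod_bd \<mu> L \<or> (h, f \<alpha>) \<in> less_mod_bd \<mu> L"
    using f_cof[OF h] by blast
  obtain \<alpha>' where \<alpha>': "\<alpha> \<noteq> \<alpha>'" "(\<alpha>, \<alpha>') \<in> lam"
    using infinite_Card_order_limit[OF regular_cardinalD(1,2)[OF lam] \<alpha>(1)] by auto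
  have "{i\<in>Field \<mu>. h i \<in> underS (L i) (f \<beta> i)} \<in> cobounded_filter \<mu>" if "(\<alpha>', \<beta>) \<in> lam" for \<beta>
  proof -
    have "\<alpha> \<in> underS lam \<beta>"
      using \<alpha>' that linlam unfolding underS_def order_on_defs
      by (auto dest: transD antisymD)
    then have "(f \<alpha>, f \<beta>) \<in> less_mod_bd \<mu> L"
      using that by (intro f_mono) (auto simp: Field_def)
    then have fin: "{i\<in>Field \<mu>. f \<alpha> i \<in> underS (L i) (f \<beta> i)} \<in> cobounded_filter \<mu>"
      by (simp add: less_mod_bd_def)
    have "{i\<in>Field \<mu>. h i = f \<alpha> i} \<in> cobounded_filter \<mu> \<or>
          {i\<in>Field \<mu>. h i \<in> underS (L i) (f \<alpha> i)} \<in> cobounded_filter \<mu>"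
      using \<alpha>(2) by (auto simp: eq_mod_bd_def less_mod_bd_def)
    then have "{i\<in>Field \<mu>. h i = f \<alpha> i \<or> h i \<in> underS (L i) (f \<alpha> i)} \<in> cobounded_filter \<mu>"
      by (auto elim: cobounded_filter_mono)
    then have "{i\<in>Field \<mu>. h i = f \<alpha> i \<or> h i \<in> underS (L i) (f \<alpha> i)} \<inter>
        {i\<in>Field \<mu>. f \<alpha> i \<in> underS (L i) (f \<beta> i)} \<in> cobounded_filter \<mu>"
      using fin regular_cardinalD(1)[OF mu] by (intro cobounded_filter_Int)
    moreover have "h i \<in> underS (L i) (f \<beta> i)"
      if "i \<in> Field \<mu>" "h i \<in> underS (L i) (f \<alpha> i)" "f \<alpha> i \<in> underS (L i) (f \<beta> i)" for i
      using in_underS_trans[OF regular_cardinalD(6)[OF L[OF that(1)]] _ that(3)] that(2)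
      by (auto simp: underS_def)
    ultimately show ?thesis by (elim cobounded_filter_mono) auto
  qed
  then show ?thesis using \<alpha>'(2) by (auto simp: Field_def)
qed

text \<open>
  If every \<open>i\<close> in \<open>U\<close> had a bad value \<open>b i\<close>, some member of the scale, and then all later ones, would exceed
  \<open>b\<close> at all but boundedly many \<open>i\<close> in \<open>U\<close>. A tuple with all its entries that late exceeds \<open>b\<close> in all its
  entries at a common \<open>i\<close> in \<open>U\<close>, since \<open>K\<close> is finite.
\<close>

lemma unbounded_coordinate:
  assumes U: "U \<subseteq> Field \<mu>" "\<And>j. j \<in> Field \<mu> \<Longrightarrow> \<exists>i\<in>U. i \<notin> underS \<mu> j"
    and K: "finite K"
    and cof: "\<And>\<gamma>. \<gamma> \<in> Field lam \<Longrightarrow> \<exists>x\<in>X. \<forall>k\<in>K. (\<gamma>, a x k) \<in> lam"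
  shows "\<exists>i\<in>U. \<forall>\<nu>\<in>Field (L i). \<exists>x\<in>X. \<forall>k\<in>K. \<nu> \<in> underS (L i) (f (a x k) i)"
proof (rule ccontr)
  assume "\<not> ?thesis"
  then obtain b where b: "\<And>i. i \<in> U \<Longrightarrow> b i \<in> Field (L i)"
    "\<And>i x. i \<in> U \<Longrightarrow> x \<in> X \<Longrightarrow> \<exists>k\<in>K. b i \<notin> underS (L i) (f (a x k) i)"
    by metis
  obtain \<alpha>0 where \<alpha>0: "\<alpha>0 \<in> Field lam" using regular_cardinalD(2)[OF lam] by fastforce
  \<comment> \<open>outside \<open>U\<close> any element of the product serves to make \<open>h\<close> total\<close>
  define h where "h i = (if i \<in> U then b i else f \<alpha>0 i)" for i
  have "h \<in> card_product (Field \<mu>) L"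
    using b(1) f_in[OF \<alpha>0] U(1) by (auto simp: h_def card_product_def PiE_iff extensional_def)
  then obtain \<alpha> where \<alpha>: "\<alpha> \<in> Field lam"
    "\<And>\<beta>. (\<alpha>, \<beta>) \<in> lam \<Longrightarrow> {i\<in>Field \<mu>. h i \<in> underS (L i) (f \<beta> i)} \<in> cobounded_filter \<mu>"
    using eventually_dominates by blast
  obtain x where x: "x \<in> X" "\<And>k. k \<in> K \<Longrightarrow> (\<alpha>, a x k) \<in> lam" using cof[OF \<alpha>(1)] by blast
  have "{i\<in>Field \<mu>. \<forall>k\<in>K. h i \<in> underS (L i) (f (a x k) i)} \<in> cobounded_filter \<mu>"
    using mu K \<alpha>(2) x(2) by (intro cobounded_filter_finite_Ball) (auto simp: regular_cardinal_def)
  then obtain j where j: "j \<in> Field \<mu>"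
    "\<And>i. i \<in> Field \<mu> \<Longrightarrow> i \<notin> underS \<mu> j \<Longrightarrow> \<forall>k\<in>K. h i \<in> underS (L i) (f (a x k) i)"
    unfolding cobounded_filter_def by blast
  obtain i where "i \<in> U" "i \<notin> underS \<mu> j" using U(2)[OF j(1)] by blast
  then show False using j(2)[of i] U(1) b(2)[of i x] x(1) by (auto simp: h_def)
qed

text \<open>
  The heart of the upper bound. At the coordinate \<open>i\<close> from \<open>unbounded_coordinate\<close> the pattern of a
  tuple is the family of its restrictions below \<open>i\<close>. There are fewer than \<open>L i\<close> patterns, so the values
  at \<open>i\<close> are unbounded already among the tuples of one fixed pattern.
\<close>

lemma same_below_and_less:
  assumes U: "U \<subseteq> Field \<mu>" "\<And>j. j \<in> Field \<mu> \<Longrightarrow> \<exists>i\<in>U. i \<notin> underS \<mu> j"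
    and K: "finite K"
    and a: "\<And>x k. x \<in> X \<Longrightarrow> k \<in> K \<Longrightarrow> a x k \<in> Field lam"
    and cof: "\<And>\<gamma>. \<gamma> \<in> Field lam \<Longrightarrow> \<exists>x\<in>X. \<forall>k\<in>K. (\<gamma>, a x k) \<in> lam"
  shows "\<exists>i\<in>U. \<exists>x\<in>X. \<exists>y\<in>X. \<forall>k\<in>K. (\<forall>j\<in>underS \<mu> i. f (a x k) j = f (a y k) j) \<and>
           f (a x k) i \<in> underS (L i) (f (a y k) i)"
proof -
  obtain i where i: "i \<in> U"
    and unb: "\<And>\<nu>. \<nu> \<in> Field (L i) \<Longrightarrow> \<exists>x\<in>X. \<forall>k\<in>K. \<nu> \<in> underS (L i) (f (a x k) i)"
    using unbounded_coordinate[OF U K cof] by blast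
  have iF: "i \<in> Field \<mu>" using i U(1) by auto
  note Li = L[OF iF]
  let ?B = "K \<rightarrow>\<^sub>E card_product (underS \<mu> i) L"
  let ?pat = "\<lambda>x. \<lambda>k\<in>K. restrict (f (a x k)) (underS \<mu> i)"
  have sub: "underS \<mu> i \<subseteq> Field \<mu>" by (auto simp: underS_def Field_def)
  have val: "f (a x k) j \<in> Field (L j)" if "x \<in> X" "k \<in> K" "j \<in> Field \<mu>" for x k j
    using f_in[OF a[OF that(1,2)]] that(3) by (auto simp: card_product_def)
  have pat: "?pat x \<in> ?B" if "x \<in> X" for x
    using val that sub by (auto simp: card_product_def)
  have B: "|?B| <o L i" by (rule card_of_PiE_finite_ordLess[OF Li small[OF iF] K])
  let ?Q = "\<lambda>\<nu> x. \<forall>k\<in>K. \<nu> \<in> underS (L i) (f (a x k) i)"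
  have "\<exists>p\<in>?B. \<forall>\<nu>\<in>Field (L i). \<exists>x\<in>X. ?pat x = p \<and> ?Q \<nu> x"
  proof (rule cofinal_pigeonhole[where Q = ?Q, OF Li _ unb pat B])
    fix \<nu> \<nu>' x assume "(\<nu>, \<nu>') \<in> L i" "?Q \<nu>' x"
    then show "?Q \<nu> x" using in_underS_trans[OF regular_cardinalD(6)[OF Li]] by blast
  qed
  then obtain p where p: "\<And>\<nu>. \<nu> \<in> Field (L i) \<Longrightarrow>
      \<exists>x\<in>X. ?pat x = p \<and> (\<forall>k\<in>K. \<nu> \<in> underS (L i) (f (a x k) i))"
    by blast
  obtain \<nu>0 where "\<nu>0 \<in> Field (L i)" using regular_cardinalD(2)[OF Li] by fastforce
  then obtain x where x: "x \<in> X" "?pat x = p" using p by blast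
  have "(\<lambda>k. f (a x k) i) ` K \<subseteq> Field (L i)" using val[OF x(1)] iF by auto
  from small_subset_bounded[OF Li this finite_ordLess_regular[OF Li finite_imageI[OF K]]]
  obtain \<nu> where \<nu>: "\<nu> \<in> Field (L i)" "\<And>k. k \<in> K \<Longrightarrow> f (a x k) i \<in> underS (L i) \<nu>"
    by (elim bexE) simp
  obtain y where y: "y \<in> X" "?pat y = p" "\<And>k. k \<in> K \<Longrightarrow> \<nu> \<in> underS (L i) (f (a y k) i)"
    using p[OF \<nu>(1)] by blast
  have "f (a x k) j = f (a y k) j" if "k \<in> K" "j \<in> underS \<mu> i" for k j
  proof -
    have "?pat x k j = ?pat y k j" using x(2) y(2) by simp
    then show ?thesis using that by simp
  qed
  moreover have "f (a x k) i \<in> underS (L i) (f (a y k) i)" if "k \<in> K" for k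
    using in_underS_trans[OF regular_cardinalD(6)[OF Li] _ y(3)[OF that]] \<nu>(2)[OF that]
    by (auto simp: underS_def)
  ultimately show ?thesis using i x(1) y(1) by blast
qed

end

section \<open>The linear order\<close>

definition twisted_lex :: "'a rel \<Rightarrow> ('a \<Rightarrow> 'b rel) \<Rightarrow> ('a \<Rightarrow> nat) \<Rightarrow> nat \<Rightarrow> ('a \<Rightarrow> 'b) rel" where
  "twisted_lex W L c k = lex_order W (\<lambda>i. if c i = k then (L i)\<inverse> else L i)"

text \<open>
  All twisted orders live on the same product.
\<close>

lemma card_product_converse:
  "card_product I (\<lambda>i. if P i then (L i)\<inverse> else L i) = card_product I L"
  unfolding card_product_def by (rule PiE_cong) simp

lemma linear_order_twisted_lex:
  assumes "Well_order W" "\<And>i. i \<in> Field W \<Longrightarrow> Linear_order (L i)"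
  shows "linear_order_on (card_product (Field W) L) (twisted_lex W L c k)"
proof -
  let ?R = "\<lambda>i. if c i = k then (L i)\<inverse> else L i"
  note card_product_converse[of "Field W" "\<lambda>i. c i = k" L]
  moreover have "linear_order_on (card_product (Field W) ?R) (lex_order W ?R)"
    using assms by (intro linear_order_lex_order) auto
  ultimately show ?thesis by (simp add: twisted_lex_def)
qed

lemma twisted_lex_at_first_difference:
  assumes i: "i \<in> Field W" and "f \<in> card_product (Field W) L" "g \<in> card_product (Field W) L"
    and "\<forall>j\<in>underS W i. f j = g j" "f i \<in> underS (L i) (g i)"
  shows "if c i = k then (g, f) \<in> twisted_lex W L c k else (f, g) \<in> twisted_lex W L c k"
proof -
  note card_product_converse[of "Field W" "\<lambda>i. c i = k" L]
  moreover have "f i \<noteq> g i" "(f i, g i) \<in> L i"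
    using assms(5) by (auto simp: underS_def)
  moreover have "\<forall>j\<in>underS W i. g j = f j" using assms(4) by simp
  ultimately show ?thesis
    using assms(1-4) unfolding twisted_lex_def lex_order_def
    by (cases "c i = k") (auto intro!: bexI[of _ i])
qed

lemma antichain_in_power_orderD:
  assumes "antichain_in (power_order J n) A"
  shows "A \<subseteq> {..<n} \<rightarrow>\<^sub>E Field J"
    and "\<And>x y. x \<in> A \<Longrightarrow> y \<in> A \<Longrightarrow> (\<And>k. k < n \<Longrightarrow> (x k, y k) \<in> J) \<Longrightarrow> x = y"
proof -
  have "Field (power_order J n) \<subseteq> {..<n} \<rightarrow>\<^sub>E Field J"
    by (auto simp: power_order_def Field_def)
  then show A: "A \<subseteq> {..<n} \<rightarrow>\<^sub>E Field J"
    using assms by (auto simp: antichain_in_def)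
  show "x = y" if "x \<in> A" "y \<in> A" "\<And>k. k < n \<Longrightarrow> (x k, y k) \<in> J" for x y
  proof -
    have "(x, y) \<in> power_order J n" using A that by (auto simp: power_order_def)
    then show ?thesis using assms that(1,2) unfolding antichain_in_def by blast
  qed
qed

text \<open>
  The bijection \<open>e\<close> reads an element of the cardinal as a pair \<open>(k, \<alpha>)\<close>, the point \<open>\<alpha>\<close> in the \<open>k\<close>-th copy;
  it serves to carry the sum of \<open>n + 1\<close> copies over to \<open>Field lam\<close>.
\<close>

locale coloured_scale = scale \<mu> L lam f
  for \<mu> :: "'a rel" and L :: "'a \<Rightarrow> 'b rel" and lam :: "'c rel" and f :: "'c \<Rightarrow> 'a \<Rightarrow> 'b" +
  fixes n :: nat and c :: "'a \<Rightarrow> nat" and e :: "'c \<Rightarrow> nat \<times> 'c"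
  assumes c_le: "\<And>i. i \<in> Field \<mu> \<Longrightarrow> c i \<le> n"
    and c_unbounded: "\<And>k j. k \<le> n \<Longrightarrow> j \<in> Field \<mu> \<Longrightarrow> \<exists>i\<in>Field \<mu>. c i = k \<and> i \<notin> underS \<mu> j"
    and e: "bij_betw e (Field lam) ({..n} \<times> Field lam)"
begin

abbreviation T :: "nat \<Rightarrow> ('a \<Rightarrow> 'b) rel" where
  "T \<equiv> twisted_lex \<mu> L c"

definition J :: "'c rel" where
  "J = sum_order (Field lam) (\<lambda>u. fst (e u)) (\<lambda>u. f (snd (e u))) T"

definition point :: "nat \<Rightarrow> 'c \<Rightarrow> 'c" where
  "point k \<alpha> = inv_into (Field lam) e (k, \<alpha>)"

lemma
  assumes "k \<le> n" "\<alpha> \<in> Field lam"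
  shows point_in: "point k \<alpha> \<in> Field lam" and e_point: "e (point k \<alpha>) = (k, \<alpha>)"
proof -
  have "(k, \<alpha>) \<in> e ` Field lam" using e assms by (auto simp: bij_betw_def)
  then show "point k \<alpha> \<in> Field lam" "e (point k \<alpha>) = (k, \<alpha>)"
    unfolding point_def by (rule inv_into_into, rule f_inv_into_f)
qed

lemma e_in: "u \<in> Field lam \<Longrightarrow> fst (e u) \<le> n \<and> snd (e u) \<in> Field lam"
  using bij_betwE[OF e] by (auto simp: mem_Times_iff)

lemma linear_order_J: "linear_order_on (Field lam) J"
  unfolding J_def
proof (rule linear_order_sum_order[where E = "card_product (Field \<mu>) L"])
  show "linear_order_on (card_product (Field \<mu>) L) (T k)" for k
    using regular_cardinalD(3)[OF mu] regular_cardinalD(6)[OF L] by (rule linear_order_twisted_lex)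
  show "f (snd (e u)) \<in> card_product (Field \<mu>) L" if "u \<in> Field lam" for u
    using e_in[OF that] f_in by blast
  show "inj_on (\<lambda>u. (fst (e u), f (snd (e u)))) (Field lam)"
  proof (rule inj_onI)
    fix u v assume uv: "u \<in> Field lam" "v \<in> Field lam"
      "(fst (e u), f (snd (e u))) = (fst (e v), f (snd (e v)))"
    then have "snd (e u) = snd (e v)" using inj_onD[OF f_inj] e_in by blast
    then have "e u = e v" using uv(3) by (simp add: prod_eq_iff)
    then show "u = v" using e uv(1,2) by (auto simp: bij_betw_def inj_on_def)
  qed
qed

lemma Field_J: "Field J = Field lam"
  using linear_order_J unfolding order_on_defs refl_on_def Field_def by blast

lemma J_at_first_difference:
  assumes u: "u \<in> Field lam" "v \<in> Field lam" "fst (e u) = k" "fst (e v) = k"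
    and i: "i \<in> Field \<mu>" "\<forall>j\<in>underS \<mu> i. f (snd (e u)) j = f (snd (e v)) j"
      "f (snd (e u)) i \<in> underS (L i) (f (snd (e v)) i)"
  shows "if c i = k then (v, u) \<in> J else (u, v) \<in> J"
  using twisted_lex_at_first_difference[OF i(1) f_in f_in i(2,3), of c k] e_in[OF u(1)] e_in[OF u(2)] u
  by (auto simp: J_def sum_order_def)

lemma J_antisym: "(u, v) \<in> J \<Longrightarrow> (v, u) \<in> J \<Longrightarrow> u = v"
  using linear_order_J by (auto simp: order_on_defs dest: antisymD)

text \<open>
  The antichain is the diagonal. A first difference of colour \<open>k\<close> is reversed in copy \<open>k\<close> only, and
  \<open>n \<ge> 1\<close> provides a second copy to disagree with it.
\<close>

lemma large_antichain:
  assumes n: "n \<ge> 1"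
  shows "\<exists>A. antichain_in (power_order J (n + 1)) A \<and> |A| =o lam"
proof -
  define d where "d \<alpha> = (\<lambda>k\<in>{..<n+1}. point k \<alpha>)" for \<alpha>
  have d: "d \<alpha> k = point k \<alpha>" if "k \<le> n" for \<alpha> k using that by (simp add: d_def)
  have d_in: "d \<alpha> \<in> {..<n+1} \<rightarrow>\<^sub>E Field J" if "\<alpha> \<in> Field lam" for \<alpha>
    using that by (auto simp: d_def Field_J point_in)
  have J_refl: "(u, u) \<in> J" if "u \<in> Field lam" for u
    using linear_order_J that by (simp add: order_on_defs refl_on_def)
  have inj: "inj_on d (Field lam)"
  proof (rule inj_onI)
    fix \<alpha> \<beta> assume "\<alpha> \<in> Field lam" "\<beta> \<in> Field lam" "d \<alpha> = d \<beta>"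
    then have "e (point 0 \<alpha>) = e (point 0 \<beta>)" using d[of 0 \<alpha>] d[of 0 \<beta>] by simp
    then show "\<alpha> = \<beta>" using \<open>\<alpha> \<in> Field lam\<close> \<open>\<beta> \<in> Field lam\<close> by (simp add: e_point)
  qed
  have inc: "(d \<alpha>, d \<beta>) \<notin> power_order J (n+1) \<and> (d \<beta>, d \<alpha>) \<notin> power_order J (n+1)"
    if "\<alpha> \<in> Field lam" "\<beta> \<in> Field lam" "i \<in> Field \<mu>" "\<forall>j\<in>underS \<mu> i. f \<alpha> j = f \<beta> j"
      "f \<alpha> i \<in> underS (L i) (f \<beta> i)" for \<alpha> \<beta> i
  proof -
    have cmp: "if c i = k then (d \<beta> k, d \<alpha> k) \<in> J else (d \<alpha> k, d \<beta> k) \<in> J" if "k \<le> n" for k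
      using J_at_first_difference[of "point k \<alpha>" "point k \<beta>" k i] point_in e_point d that
        \<open>\<alpha> \<in> Field lam\<close> \<open>\<beta> \<in> Field lam\<close> \<open>i \<in> Field \<mu>\<close> \<open>\<forall>j\<in>underS \<mu> i. f \<alpha> j = f \<beta> j\<close>
        \<open>f \<alpha> i \<in> underS (L i) (f \<beta> i)\<close> by simp
    have neq: "d \<alpha> k \<noteq> d \<beta> k" if "k \<le> n" for k
    proof
      assume "d \<alpha> k = d \<beta> k"
      then have "e (point k \<alpha>) = e (point k \<beta>)" using d that by simp
      then have "\<alpha> = \<beta>" using that \<open>\<alpha> \<in> Field lam\<close> \<open>\<beta> \<in> Field lam\<close> by (simp add: e_point)
      then show False using \<open>f \<alpha> i \<in> underS (L i) (f \<beta> i)\<close> by (simp add: underS_def)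
    qed
    obtain k where k: "k \<le> n" "k \<noteq> c i" using n by (metis le0 zero_neq_one)
    have "(d \<beta> (c i), d \<alpha> (c i)) \<in> J" "(d \<alpha> k, d \<beta> k) \<in> J"
      using cmp[of "c i"] cmp[of k] k c_le \<open>i \<in> Field \<mu>\<close> by auto
    then have "(d \<alpha> (c i), d \<beta> (c i)) \<notin> J" "(d \<beta> k, d \<alpha> k) \<notin> J"
      using J_antisym neq k(1) c_le[OF \<open>i \<in> Field \<mu>\<close>] by metis+
    then show ?thesis
      using k(1) c_le[OF \<open>i \<in> Field \<mu>\<close>] unfolding power_order_def by fastforce
  qed
  have "antichain_in (power_order J (n+1)) (d ` Field lam)"
    unfolding antichain_in_def
  proof (intro conjI subsetI ballI impI)
    fix x assume "x \<in> d ` Field lam"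
    then have "(x, x) \<in> power_order J (n+1)"
      using d_in J_refl by (fastforce simp: power_order_def Field_J PiE_iff)
    then show "x \<in> Field (power_order J (n+1))" by (auto simp: Field_def)
  next
    fix x y assume xy: "x \<in> d ` Field lam" "y \<in> d ` Field lam" "x \<noteq> y"
    then obtain \<alpha> \<beta> where \<alpha>\<beta>: "\<alpha> \<in> Field lam" "\<beta> \<in> Field lam" "x = d \<alpha>" "y = d \<beta>" by auto
    then have "f \<alpha> \<noteq> f \<beta>" using xy(3) inj_onD[OF f_inj] by blast
    then obtain i where i: "i \<in> Field \<mu>" "\<forall>j\<in>underS \<mu> i. f \<alpha> j = f \<beta> j" "f \<alpha> i \<noteq> f \<beta> i"
      using first_difference[OF regular_cardinalD(3)[OF mu]] f_in[OF \<alpha>\<beta>(1)] f_in[OF \<alpha>\<beta>(2)]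
      unfolding card_product_def by blast
    have "f \<alpha> i \<in> Field (L i)" "f \<beta> i \<in> Field (L i)"
      using f_in \<alpha>\<beta>(1,2) i(1) by (auto simp: card_product_def)
    then have "f \<alpha> i \<in> underS (L i) (f \<beta> i) \<or> f \<beta> i \<in> underS (L i) (f \<alpha> i)"
      using in_underS_or_le[OF regular_cardinalD(6)[OF L[OF i(1)]], of "f \<alpha> i" "f \<beta> i"] i(3)
      by (auto simp: underS_def)
    then show "(x, y) \<notin> power_order J (n+1)" "(y, x) \<notin> power_order J (n+1)"
      using inc[OF \<alpha>\<beta>(1,2) i(1,2)] inc[OF \<alpha>\<beta>(2,1) i(1)] i(2) \<alpha>\<beta>(3,4) by auto
  qed
  moreover have "|d ` Field lam| =o lam"
  proof (rule ordIso_transitive)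
    show "|d ` Field lam| =o |Field lam|"
      using card_of_ordIsoI[OF inj_on_imp_bij_betw[OF inj]] by (rule ordIso_symmetric)
    show "|Field lam| =o lam" using regular_cardinalD(1)[OF lam] by (rule card_of_Field_ordIso)
  qed
  ultimately show ?thesis by blast
qed

text \<open>
  The \<open>n\<close> positions cannot meet all \<open>n + 1\<close> copies. First differences are therefore sought at coordinates
  whose colour is that of a missed copy, where every copy in use compares forwards.
\<close>

lemma no_large_antichain: "\<not> (\<exists>A. antichain_in (power_order J n) A \<and> |A| =o lam)"
proof
  assume "\<exists>A. antichain_in (power_order J n) A \<and> |A| =o lam"
  then obtain A where A: "antichain_in (power_order J n) A" "|A| =o lam" by blast
  note AD = antichain_in_power_orderD[OF A(1)]
  have xk: "x k \<in> Field lam" if "x \<in> A" "k < n" for x k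
    using AD(1) that by (auto simp: Field_J)
  have finite: "finite ({..<n} \<rightarrow>\<^sub>E {..n})" by (intro finite_PiE) auto
  have "(\<lambda>k\<in>{..<n}. fst (e (x k))) \<in> {..<n} \<rightarrow>\<^sub>E {..n}" if "x \<in> A" for x
    using xk[OF that] e_in by auto
  then have "\<exists>t\<in>{..<n} \<rightarrow>\<^sub>E {..n}. |{x\<in>A. (\<lambda>k\<in>{..<n}. fst (e (x k))) = t}| =o lam"
    by (rule fibre_of_full_size[OF lam A(2) _ finite_ordLess_regular[OF lam finite]])
  then obtain t where t: "|{x\<in>A. (\<lambda>k\<in>{..<n}. fst (e (x k))) = t}| =o lam" by (elim bexE)
  \<comment> \<open>\<open>t k\<close> is the copy that position \<open>k\<close> of the remaining tuples lies in\<close>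
  define A1 where "A1 = {x\<in>A. (\<lambda>k\<in>{..<n}. fst (e (x k))) = t}"
  have A1: "A1 \<subseteq> A" "|A1| =o lam" using t by (auto simp: A1_def)
  have col: "fst (e (x k)) = t k" if "x \<in> A1" "k < n" for x k
    using that by (auto simp: A1_def)
  have "card (t ` {..<n}) < card {..n}"
    using card_image_le[of "{..<n}" t] by simp
  then have "\<not> {..n} \<subseteq> t ` {..<n}" using card_mono[of "t ` {..<n}" "{..n}"] by auto
  then obtain l where l: "l \<le> n" "\<And>k. k < n \<Longrightarrow> t k \<noteq> l" by blast
  have same: "x k = y k" if "x \<in> A1" "y \<in> A1" "k < n" "snd (e (x k)) = snd (e (y k))" for x y k
  proof -
    have "e (x k) = e (y k)" using that col by (simp add: prod_eq_iff)
    then show ?thesis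
      using bij_betw_imp_inj_on[OF e] xk that A1(1) by (meson inj_onD subsetD)
  qed
  have "\<exists>A' K. A' \<subseteq> A1 \<and> K \<subseteq> {..<n} \<and> K \<noteq> {} \<and>
      (\<forall>x\<in>A'. \<forall>y\<in>A'. \<forall>k\<in>{..<n} - K. snd (e (x k)) = snd (e (y k))) \<and>
      (\<forall>\<gamma>\<in>Field lam. \<exists>x\<in>A'. \<forall>k\<in>K. (\<gamma>, snd (e (x k))) \<in> lam)"
  proof (rule thin_to_constant_or_unbounded[OF lam A1(2)])
    show "snd (e (x k)) \<in> Field lam" if "x \<in> A1" "k \<in> {..<n}" for x k
      using xk that A1(1) e_in by auto
    show "x = y" if "x \<in> A1" "y \<in> A1" "\<And>k. k \<in> {..<n} \<Longrightarrow> snd (e (x k)) = snd (e (y k))" for x y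
    proof (rule PiE_ext)
      show "x \<in> {..<n} \<rightarrow>\<^sub>E Field J" "y \<in> {..<n} \<rightarrow>\<^sub>E Field J" using AD(1) A1(1) that by auto
    qed (use same that in auto)
  qed simp
  then obtain A' K where A': "A' \<subseteq> A1" and K: "K \<subseteq> {..<n}" "K \<noteq> {}"
    and const: "\<And>x y k. x \<in> A' \<Longrightarrow> y \<in> A' \<Longrightarrow> k \<in> {..<n} - K \<Longrightarrow> snd (e (x k)) = snd (e (y k))"
    and cof: "\<And>\<gamma>. \<gamma> \<in> Field lam \<Longrightarrow> \<exists>x\<in>A'. \<forall>k\<in>K. (\<gamma>, snd (e (x k))) \<in> lam"
    by metis
  have xk': "x k \<in> Field lam" if "x \<in> A'" "k < n" for x k using xk that A' A1(1) by blast
  have "\<exists>i\<in>{i\<in>Field \<mu>. c i = l}. \<exists>x\<in>A'. \<exists>y\<in>A'. \<forall>k\<in>K.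
      (\<forall>j\<in>underS \<mu> i. f (snd (e (x k))) j = f (snd (e (y k))) j) \<and>
      f (snd (e (x k))) i \<in> underS (L i) (f (snd (e (y k))) i)"
  proof (rule same_below_and_less)
    show "\<exists>i\<in>{i\<in>Field \<mu>. c i = l}. i \<notin> underS \<mu> j" if "j \<in> Field \<mu>" for j
      using c_unbounded[OF l(1) that] by auto
    show "finite K" using K(1) finite_subset by blast
    show "snd (e (x k)) \<in> Field lam" if "x \<in> A'" "k \<in> K" for x k
      using xk' that K(1) e_in by auto
  qed (use cof in auto)
  then obtain i x y where i: "i \<in> Field \<mu>" "c i = l" and x: "x \<in> A'" and y: "y \<in> A'"
    and below: "\<And>k. k \<in> K \<Longrightarrow> \<forall>j\<in>underS \<mu> i. f (snd (e (x k))) j = f (snd (e (y k))) j"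
    and less: "\<And>k. k \<in> K \<Longrightarrow> f (snd (e (x k))) i \<in> underS (L i) (f (snd (e (y k))) i)"
    by blast
  have "(x k, y k) \<in> J" if k: "k < n" for k
  proof (cases "k \<in> K")
    case True
    have "fst (e (x k)) = t k" "fst (e (y k)) = t k" using col x y A' k by auto
    then show ?thesis
      using J_at_first_difference[OF xk'[OF x k] xk'[OF y k] _ _ i(1) below[OF True] less[OF True]]
        i(2) l(2)[OF k] by auto
  next
    case False
    then have "snd (e (x k)) = snd (e (y k))" using const[OF x y] k by simp
    then have "x k = y k" using same x y A' k by blast
    then show ?thesis using linear_order_J xk'[OF y k] by (simp add: order_on_defs refl_on_def)
  qed
  then have "x = y" using AD(2) x y A' A1(1) by blast
  then show False using less K(2) by (auto simp: underS_def)
qed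

end

theorem theorem2p1:
  fixes \<mu> :: "'a rel" and lam :: "'c rel" and L :: "'a \<Rightarrow> 'b rel" and n :: nat
  assumes "regular_cardinal \<mu>"
    and "Card_order lam"
    and "\<forall>i\<in>Field \<mu>. regular_cardinal (L i)"
    and "\<forall>j\<in>Field \<mu>. \<forall>i\<in>underS \<mu> j. L i <o L j"
    and "\<forall>j\<in>Field \<mu>. |card_product (underS \<mu> j) L| <o L j"
    and "regular_cardinal lam"
    and "is_tcf (reduced_product \<mu> L) lam"
    and "n \<ge> 2"
  shows "\<exists>J :: 'c rel. Linear_order J \<and> |Field J| =o lam \<and>
           (\<exists>A. antichain_in (power_order J (n + 1)) A \<and> |A| =o lam) \<and>
           \<not> (\<exists>A. antichain_in (power_order J n) A \<and> |A| =o lam)"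
proof -
  obtain f where f: "scale \<mu> L lam f"
    using scale_of_is_tcf[OF assms(1,3,5,7)] by blast
  obtain c :: "'a \<Rightarrow> nat" where c: "\<forall>i\<in>Field \<mu>. c i \<le> n"
    "\<forall>k\<le>n. \<forall>j\<in>Field \<mu>. \<exists>i\<in>Field \<mu>. c i = k \<and> i \<notin> underS \<mu> j"
    using unbounded_colouring[of \<mu> n] assms(1) by (auto simp: regular_cardinal_def)
  obtain e where e: "bij_betw e (Field lam) ({..n} \<times> Field lam)"
    using ex_bij_betw_finite_Times[of "Field lam" "{..n}"] regular_cardinalD(2)[OF assms(6)] by auto
  interpret coloured_scale \<mu> L lam f n c e
    using f c e by (auto simp: coloured_scale_def coloured_scale_axioms_def)
  have "Linear_order J" "|Field J| =o lam"
    using linear_order_J card_of_Field_ordIso[OF assms(2)] by (simp_all add: Field_J)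
  moreover have "\<exists>A. antichain_in (power_order J (n + 1)) A \<and> |A| =o lam"
    using assms(8) by (intro large_antichain) simp
  ultimately show ?thesis
    using no_large_antichain by (intro exI[of _ J] conjI)
qed

end
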